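(* Let $(V,D,C)$ be a constraint satisfaction problem with solution set $\mathcal{S}$, and let $\mathcal{X}\subseteq V$ be a set of Boolean (0/1-valued) variables. Let $\preceq_{\mathcal{X}}$ be the preorder on $\mathcal{S}$ defined by $X\preceq_{\mathcal{X}} Y \Leftrightarrow X(v)\le Y(v)$ for all $v\in\mathcal{X}$. Then the full solution to the constraint dominance problem $(V,D,C,\preceq_{\mathcal{X}})$ equals the set of $\mathcal{X}$-minimal models of $(V,D,C)$, i.e. the set $$\{X\in\mathcal{S}\mid \nexists\, Y\in\mathcal{S}:\ pos_{\mathcal{X}}(Y)\subsetneq pos_{\mathcal{X}}(X)\}, \qquad pos_{\mathcal{X}}(X)=\{v\in\mathcal{X}\mid X(v)=1\}.$$
   Context: A constraint satisfaction problem (CSP) is a triple $(V,D,C)$, where $V$ is a set of variables, $D$ maps each variable $v$ to a set of values $D(v)$, and $C$ is a set of constraints (arbitrary relations over subsets of $V$). A solution is an assignment $X$ with $X(v)\in D(v)$ for every $v\in V$ that satisfies every constraint in $C$; $\mathcal{S}$ denotes the set of all solutions. A dominance relation $\preceq$ is a preorder (reflexive and transitive relation) on $\mathcal{S}$; $X\sim Y$ means $X\preceq Y$ and $Y\preceq X$. A constraint dominance problem (CDP) is a tuple $(V,D,C,\preceq)$ with $(V,D,C)$ a CSP and $\preceq$ a dominance relation. The full solution to the CDP is the set $\{X\in\mathcal{S}\mid \forall Y\in\mathcal{S}:\ Y\not\preceq X \vee X\sim Y\}$, equivalently $\{X\in\mathcal{S}\mid \nexists\, Y\in\mathcal{S}:\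 Y\preceq X\wedge X\nsim Y\}$. An $\mathcal{X}$-minimal model is a solution $X$ such that no solution $Y$ satisfies $pos_{\mathcal{X}}(Y)\subsetneq pos_{\mathcal{X}}(X)$. *)

theory Defs
  imports "HOL-Library.FuncSet"
begin

(* A constraint (U, R) consists of its scope U and a relation R over U, given as a set of
   assignments to U.  An assignment to U is a function that is undefined outside U. *)
record ('v, 'a) csp =
  csp_vars :: "'v set"
  csp_dom :: "'v \<Rightarrow> 'a set"
  csp_constraints :: "('v set \<times> ('v \<Rightarrow> 'a) set) set"

definition is_csp :: "('v, 'a) csp \<Rightarrow> bool" where
  "is_csp P \<longleftrightarrow>
     (\<forall>(U, R) \<in> csp_constraints P. U \<subseteq> csp_vars P \<and> R \<subseteq> extensional U)"

definition satisfies :: "('v \<Rightarrow> 'a) \<Rightarrow> 'v set \<times> ('v \<Rightarrow> 'a) set \<Rightarrow> bool" where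
  "satisfies X c \<longleftrightarrow> restrict X (fst c) \<in> snd c"

definition solutions :: "('v, 'a) csp \<Rightarrow> ('v \<Rightarrow> 'a) set" where
  "solutions P =
     {X \<in> PiE (csp_vars P) (csp_dom P). \<forall>c \<in> csp_constraints P. satisfies X c}"

(* Throughout, (X, Y) \<in> r reads "X \<preceq> Y". *)

definition is_cdp :: "('v, 'a) csp \<Rightarrow> ('v \<Rightarrow> 'a) rel \<Rightarrow> bool" where
  "is_cdp P r \<longleftrightarrow> is_csp P \<and> preorder_on (solutions P) r"

definition dom_equiv :: "'b rel \<Rightarrow> 'b \<Rightarrow> 'b \<Rightarrow> bool" where
  "dom_equiv r X Y \<longleftrightarrow> (X, Y) \<in> r \<and> (Y, X) \<in> r"

definition full_solution :: "('v, 'a) csp \<Rightarrow> ('v \<Rightarrow> 'a) rel \<Rightarrow> ('v \<Rightarrow> 'a) set" where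
  "full_solution P r =
     {X \<in> solutions P. \<forall>Y \<in> solutions P. (Y, X) \<notin> r \<or> dom_equiv r X Y}"

(* Only 0 < 1 is required of the values; variables outside B may take arbitrary values. *)

definition pointwise_dominance ::
    "('v, 'a::zero_less_one) csp \<Rightarrow> 'v set \<Rightarrow> ('v \<Rightarrow> 'a) rel" where
  "pointwise_dominance P B =
     {(X, Y). X \<in> solutions P \<and> Y \<in> solutions P \<and> (\<forall>v \<in> B. X v \<le> Y v)}"

definition pos :: "'v set \<Rightarrow> ('v \<Rightarrow> 'a::zero_less_one) \<Rightarrow> 'v set" where
  "pos B X = {v \<in> B. X v = 1}"

definition minimal_models ::
    "('v, 'a::zero_less_one) csp \<Rightarrow> 'v set \<Rightarrow> ('v \<Rightarrow> 'a) set" where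
  "minimal_models P B =
     {X \<in> solutions P. \<not> (\<exists>Y \<in> solutions P. pos B Y \<subset> pos B X)}"

lemma is_cdp_pointwise_dominance:
  assumes "is_csp P"
  shows "is_cdp P (pointwise_dominance P B)"
  using assms
  by (auto simp: is_cdp_def pointwise_dominance_def preorder_on_def refl_on_def
      intro!: transI intro: order_trans)

end

theory Submission
  imports Defs
begin

text \<open>For assignments that are 0/1-valued on \<open>B\<close>, the pointwise order on
  \<open>B\<close> is inclusion of the sets \<open>pos B\<close>
  (\<open>pos_subset_iff_pointwise_le\<close>). Dominance between solutions thus becomes inclusion,
  and equivalence becomes equality of these sets; a solution that dominates \<open>X\<close> without
  being equivalent to it is one with a strictly smaller \<open>pos B\<close>.\<close>

lemma solution_value_in_dom:
  assumes "X \<in> solutions P" and "v \<in> csp_vars P"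
  shows "X v \<in> csp_dom P v"
  using assms by (auto simp: solutions_def)

lemma pos_subset_iff_pointwise_le:
  fixes X Y :: "'v \<Rightarrow> 'a::zero_less_one"
  assumes "\<And>v. v \<in> B \<Longrightarrow> X v \<in> {0, 1}"
    and "\<And>v. v \<in> B \<Longrightarrow> Y v \<in> {0, 1}"
  shows "pos B X \<subseteq> pos B Y \<longleftrightarrow> (\<forall>v \<in> B. X v \<le> Y v)"
proof -
  have "(X v = 1 \<longrightarrow> Y v = 1) \<longleftrightarrow> X v \<le> Y v" if "v \<in> B" for v
  proof -
    \<comment> \<open>With reflexivity, these two comparisons settle all four combinations of
      values.\<close>
    have "(0::'a) \<le> 1" and "\<not> (1::'a) \<le> 0"
      using zero_less_one[where 'a='a] by (simp_all add: less_le_not_le)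
    then show ?thesis
      using assms(1)[OF that] assms(2)[OF that] by auto
  qed
  then show ?thesis
    by (auto simp: pos_def)
qed

theorem lemma2:
  fixes P :: "('v, 'a::zero_less_one) csp" and B :: "'v set"
  assumes "is_csp P"
    and "B \<subseteq> csp_vars P"
    and "\<And>v. v \<in> B \<Longrightarrow> csp_dom P v \<subseteq> {0, 1}"
  shows "full_solution P (pointwise_dominance P B) = minimal_models P B"
proof -
  \<comment> \<open>Since \<open>B\<close> lies within the variables, the domain bound applies on
    \<open>B\<close>.\<close>
  have boolean: "X v \<in> {0, 1}" if "X \<in> solutions P" "v \<in> B" for X v
    using solution_value_in_dom[OF that(1)] that(2) assms(2,3) by blast
  have "(X, Y) \<in> pointwise_dominance P B \<longleftrightarrow> pos B X \<subseteq> pos B Y"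
    if "X \<in> solutions P" "Y \<in> solutions P" for X Y
    using that pos_subset_iff_pointwise_le[of B X Y] boolean
    by (simp add: pointwise_dominance_def)
  then show ?thesis
    \<comment> \<open>\<open>less_le_not_le\<close> splits strict inclusion into an inclusion and a
      failed converse, so both sides say that \<open>pos B Y \<subseteq> pos B X\<close> forces the
      converse.\<close>
    by (auto simp: full_solution_def minimal_models_def dom_equiv_def less_le_not_le)
qed

end
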